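(* Let $\kappa$ be an infinite cardinal with $\kappa<2^{\aleph_0}$ and let $n\in\mathbb{N}$ ($n\geq 1$). Then: (i) the Banach space $\ell_1(\kappa)$ does not admit a tiling by balls; (ii) $\ell_1(\kappa)$ does not admit a star-$n$-finite covering by balls of positive radius.
   Context: All spaces are real; $\ell_1(\kappa)$ carries its canonical norm. A ball in a normed space is a closed ball $B(x,r)=\{y:\|y-x\|\leq r\}$. A family $\mathcal{F}$ of non-empty subsets of a normed space $\mathcal{X}$ is a covering of $\mathcal{X}$ if $\bigcup\mathcal{F}=\mathcal{X}$; it is non-overlapping if its (distinct) elements have mutually disjoint interiors; it is a tiling if it is a non-overlapping covering and each element of $\mathcal{F}$ is a closed convex set with non-empty interior. A tiling by balls is a tiling all of whose elements are balls (necessarily of positive radius; the radii may vary). For an integer $n\geq 0$, $\mathcal{F}$ is star-$n$-finite if each $F\in\mathcal{F}$ intersects at most $n$ elements of $\mathcal{F}\setminus\{F\}$. *)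

theory Defs
  imports "HOL-Analysis.Analysis" "HOL-Library.Equipollence"
begin

section \<open>The Banach space of absolutely summable real families\<close>

text \<open>
  The space \<open>\<ell>\<^sub>1(\<kappa>)\<close> is taken over an index type \<open>'i\<close> whose cardinality is \<open>\<kappa>\<close>; up to
  isometry it depends on the cardinality of \<open>'i\<close> only. For arbitrary (possibly uncountable)
  index types, summability is unconditional (net) summability.
\<close>

typedef 'i ell1 = "{f :: 'i \<Rightarrow> real. (\<lambda>i. \<bar>f i\<bar>) summable_on UNIV}"
  morphisms ell1_nth Abs_ell1
  by (intro exI[of _ "\<lambda>_. 0"]) simp

setup_lifting type_definition_ell1

lemma ell1_eqI: "(\<And>i. ell1_nth x i = ell1_nth y i) \<Longrightarrow> x = y"
  by transfer auto

lemma abs_summable_ell1_nth: "(\<lambda>i. \<bar>ell1_nth x i\<bar>) summable_on UNIV"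
  using ell1_nth[of x] by simp

lemma abs_summable_add:
  fixes f g :: "'i \<Rightarrow> real"
  assumes "(\<lambda>i. \<bar>f i\<bar>) summable_on A" "(\<lambda>i. \<bar>g i\<bar>) summable_on A"
  shows "(\<lambda>i. \<bar>f i + g i\<bar>) summable_on A"
  using assms by (simp flip: real_norm_def summable_on_iff_abs_summable_on_real add: summable_on_add)

lemma abs_summable_cmult:
  fixes f :: "'i \<Rightarrow> real"
  assumes "(\<lambda>i. \<bar>f i\<bar>) summable_on A"
  shows "(\<lambda>i. \<bar>c * f i\<bar>) summable_on A"
  using assms by (simp add: abs_mult summable_on_cmult_right)

instantiation ell1 :: (type) real_vector
begin

lift_definition zero_ell1 :: "'i ell1" is "\<lambda>_. 0"
  by simp

lift_definition plus_ell1 :: "'i ell1 \<Rightarrow> 'i ell1 \<Rightarrow> 'i ell1" is "\<lambda>f g i. f i + g i"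
  using abs_summable_add by blast

lift_definition uminus_ell1 :: "'i ell1 \<Rightarrow> 'i ell1" is "\<lambda>f i. - f i"
  by simp

lift_definition minus_ell1 :: "'i ell1 \<Rightarrow> 'i ell1 \<Rightarrow> 'i ell1" is "\<lambda>f g i. f i - g i"
  subgoal for f g
    using abs_summable_add[of f UNIV "\<lambda>i. - g i"] by simp
  done

lift_definition scaleR_ell1 :: "real \<Rightarrow> 'i ell1 \<Rightarrow> 'i ell1" is "\<lambda>c f i. c * f i"
  using abs_summable_cmult by blast

instance
  by standard (transfer; simp add: fun_eq_iff algebra_simps)+

end

instantiation ell1 :: (type) real_normed_vector
begin

lift_definition norm_ell1 :: "'i ell1 \<Rightarrow> real" is "\<lambda>f. \<Sum>\<^sub>\<infinity>i. \<bar>f i\<bar>" .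

definition dist_ell1 :: "'i ell1 \<Rightarrow> 'i ell1 \<Rightarrow> real"
  where "dist_ell1 x y = norm (x - y)"

definition sgn_ell1 :: "'i ell1 \<Rightarrow> 'i ell1"
  where "sgn_ell1 x = x /\<^sub>R norm x"

definition uniformity_ell1 :: "('i ell1 \<times> 'i ell1) filter"
  where "uniformity_ell1 = (INF e\<in>{0 <..}. principal {(x, y). dist x y < e})"

definition open_ell1 :: "'i ell1 set \<Rightarrow> bool"
  where "open_ell1 S = (\<forall>x\<in>S. \<forall>\<^sub>F (x', y) in uniformity. x' = x \<longrightarrow> y \<in> S)"

instance
proof
  fix x y :: "'i ell1" and c :: real
  show "norm x = 0 \<longleftrightarrow> x = 0"
  proof
    assume *: "norm x = 0"
    have "\<bar>ell1_nth x i\<bar> = 0" for i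
      by (rule nonneg_infsum_le_0D[where A = UNIV and f = "\<lambda>i. \<bar>ell1_nth x i\<bar>"])
        (use * abs_summable_ell1_nth[of x] in \<open>auto simp: norm_ell1.rep_eq\<close>)
    then show "x = 0"
      by (intro ell1_eqI) (simp add: zero_ell1.rep_eq)
  qed (simp add: norm_ell1.rep_eq zero_ell1.rep_eq)
  show "norm (x + y) \<le> norm x + norm y"
  proof (transfer, clarify)
    fix f g :: "'i \<Rightarrow> real"
    assume f: "(\<lambda>i. \<bar>f i\<bar>) summable_on UNIV" and g: "(\<lambda>i. \<bar>g i\<bar>) summable_on UNIV"
    have "(\<Sum>\<^sub>\<infinity>i. \<bar>f i + g i\<bar>) \<le> (\<Sum>\<^sub>\<infinity>i. \<bar>f i\<bar> + \<bar>g i\<bar>)"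
      using abs_summable_add[OF f g] summable_on_add[OF f g]
      by (intro infsum_mono) (auto simp: abs_triangle_ineq)
    also have "\<dots> = (\<Sum>\<^sub>\<infinity>i. \<bar>f i\<bar>) + (\<Sum>\<^sub>\<infinity>i. \<bar>g i\<bar>)"
      using f g by (intro infsum_add) auto
    finally show "(\<Sum>\<^sub>\<infinity>i. \<bar>f i + g i\<bar>) \<le> (\<Sum>\<^sub>\<infinity>i. \<bar>f i\<bar>) + (\<Sum>\<^sub>\<infinity>i. \<bar>g i\<bar>)" .
  qed
  show "norm (c *\<^sub>R x) = \<bar>c\<bar> * norm x"
    by transfer (simp add: abs_mult infsum_cmult_right')
qed (rule dist_ell1_def sgn_ell1_def uniformity_ell1_def open_ell1_def)+

end

lemma sum_abs_le_norm_ell1: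
  assumes "finite F"
  shows "(\<Sum>i\<in>F. \<bar>ell1_nth x i\<bar>) \<le> norm x"
  using assms abs_summable_ell1_nth[of x]
  by (auto simp: norm_ell1.rep_eq intro!: finite_sum_le_infsum)

instance ell1 :: (type) banach
proof
  fix X :: "nat \<Rightarrow> 'i ell1"
  assume X: "Cauchy X"
  have "Cauchy (\<lambda>n. ell1_nth (X n) i)" for i
  proof (rule metric_CauchyI)
    fix e :: real assume "e > 0"
    then obtain N where N: "\<And>m n. m \<ge> N \<Longrightarrow> n \<ge> N \<Longrightarrow> dist (X m) (X n) < e"
      using metric_CauchyD[OF X] by blast
    have "dist (ell1_nth (X m) i) (ell1_nth (X n) i) \<le> dist (X m) (X n)" for m n
      using sum_abs_le_norm_ell1[of "{i}" "X m - X n"]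
      by (simp add: dist_norm minus_ell1.rep_eq)
    then show "\<exists>N. \<forall>m\<ge>N. \<forall>n\<ge>N. dist (ell1_nth (X m) i) (ell1_nth (X n) i) < e"
      using N by (meson le_less_trans)
  qed
  then have "\<exists>l. (\<lambda>n. ell1_nth (X n) i) \<longlonglongrightarrow> l" for i
    by (simp add: Cauchy_convergent_iff convergent_def)
  then obtain l where l: "\<And>i. (\<lambda>n. ell1_nth (X n) i) \<longlonglongrightarrow> l i"
    by metis
  have fin: "(\<Sum>i\<in>F. \<bar>ell1_nth (X m) i - l i\<bar>) \<le> e"
    if N: "\<And>m n. m \<ge> N \<Longrightarrow> n \<ge> N \<Longrightarrow> dist (X m) (X n) < e" and "m \<ge> N" "finite F" for N m e F
  proof (rule tendsto_upperbound)
    show "(\<lambda>n. \<Sum>i\<in>F. \<bar>ell1_nth (X m) i - ell1_nth (X n) i\<bar>)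
            \<longlonglongrightarrow> (\<Sum>i\<in>F. \<bar>ell1_nth (X m) i - l i\<bar>)"
      by (intro tendsto_intros l)
    have "(\<Sum>i\<in>F. \<bar>ell1_nth (X m) i - ell1_nth (X n) i\<bar>) \<le> e" if "n \<ge> N" for n
      using sum_abs_le_norm_ell1[OF \<open>finite F\<close>, of "X m - X n"] N[OF \<open>m \<ge> N\<close> that]
      by (simp add: dist_norm minus_ell1.rep_eq)
    then show "\<forall>\<^sub>F n in sequentially. (\<Sum>i\<in>F. \<bar>ell1_nth (X m) i - ell1_nth (X n) i\<bar>) \<le> e"
      by (auto simp: eventually_sequentially)
  qed simp
  have summ: "(\<lambda>i. \<bar>ell1_nth (X m) i - l i\<bar>) summable_on UNIV"
    if "\<And>m n. m \<ge> N \<Longrightarrow> n \<ge> N \<Longrightarrow> dist (X m) (X n) < e" and "m \<ge> N" for N m e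
    using fin[OF that] by (intro nonneg_bdd_above_summable_on) (auto intro!: bdd_aboveI[of _ e])
  obtain N where "\<And>m n. m \<ge> N \<Longrightarrow> n \<ge> N \<Longrightarrow> dist (X m) (X n) < 1"
    using metric_CauchyD[OF X zero_less_one] by blast
  from summ[OF this order_refl] have "(\<lambda>i. \<bar>l i - ell1_nth (X N) i\<bar>) summable_on UNIV"
    by (simp add: abs_minus_commute)
  from abs_summable_add[OF this abs_summable_ell1_nth[of "X N"]]
  have "(\<lambda>i. \<bar>l i\<bar>) summable_on UNIV"
    by simp
  then have nth: "ell1_nth (Abs_ell1 l) = l"
    by (simp add: Abs_ell1_inverse)
  have "X \<longlonglongrightarrow> Abs_ell1 l"
  proof (rule metric_LIMSEQ_I)
    fix e :: real assume "e > 0"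
    then obtain N where N: "\<And>m n. m \<ge> N \<Longrightarrow> n \<ge> N \<Longrightarrow> dist (X m) (X n) < e / 2"
      using metric_CauchyD[OF X, of "e / 2"] by auto
    have "dist (X m) (Abs_ell1 l) < e" if "m \<ge> N" for m
    proof -
      have "(\<Sum>\<^sub>\<infinity>i. \<bar>ell1_nth (X m) i - l i\<bar>) \<le> e / 2"
        using summ[OF N that] fin[OF N that] by (intro infsum_le_finite_sums) auto
      then show ?thesis
        using \<open>e > 0\<close> by (simp add: dist_norm norm_ell1.rep_eq minus_ell1.rep_eq nth)
    qed
    then show "\<exists>N. \<forall>m\<ge>N. dist (X m) (Abs_ell1 l) < e"
      by blast
  qed
  then show "convergent X"
    by (rule convergentI)
qed


section \<open>Coverings and tilings\<close>

definition covering :: "'a::real_normed_vector set set \<Rightarrow> bool"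
  where "covering \<F> \<longleftrightarrow> (\<forall>F\<in>\<F>. F \<noteq> {}) \<and> \<Union>\<F> = UNIV"

definition non_overlapping :: "'a::real_normed_vector set set \<Rightarrow> bool"
  where "non_overlapping \<F> \<longleftrightarrow> (\<forall>F\<in>\<F>. \<forall>G\<in>\<F>. F \<noteq> G \<longrightarrow> interior F \<inter> interior G = {})"

definition tiling :: "'a::real_normed_vector set set \<Rightarrow> bool"
  where "tiling \<F> \<longleftrightarrow> covering \<F> \<and> non_overlapping \<F> \<and>
    (\<forall>F\<in>\<F>. closed F \<and> convex F \<and> interior F \<noteq> {})"

definition star_n_finite :: "nat \<Rightarrow> 'a::real_normed_vector set set \<Rightarrow> bool"
  where "star_n_finite n \<F> \<longleftrightarrow>
    (\<forall>F\<in>\<F>. finite {G \<in> \<F> - {F}. F \<inter> G \<noteq> {}} \<and> card {G \<in> \<F> - {F}. F \<inter> G \<noteq> {}} \<le> n)"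

end

(*
  A tiling and a star-n-finite covering have in common that every tile meets the interiors of
  only finitely many tiles. Restricted to a coordinate copy of l_1(N), each ball becomes a ball,
  a point or the empty set; countably many are proper balls, and fewer than continuum many are
  points. Let C be the closed set of points in no open ball. If m lies in some open ball, then
  for all large j the ray from m in direction e_j leaves the balls through a point q_j of C, at a
  time tending to a limit rho > 0 with B(m, rho) contained in a ball of the family. If m is near
  a point s of C and outside a given ball B(c, r), then so are the q_j for large j, since the
  distance from q_j to c tends to |m - c| + rho. Hence C is perfect and nowhere covered by a
  single sphere, and the Baire category theorem leaves continuum many points of C to the
  degenerate balls, which are too few.
*)

theory Submission
  imports Defs "HOL-Algebra.Free_Abelian_Groups"
begin

section \<open>Cardinality\<close>

lemma UN_lepoll_infinite:
  assumes "infinite B" "I \<lesssim> B" "\<And>i. i \<in> I \<Longrightarrow> A i \<lesssim> B"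
  shows "(\<Union>i\<in>I. A i) \<lesssim> B"
  using card_of_UNION_ordLeq_infinite[of B I A] assms
  by (simp add: lepoll_def card_of_ordLeq[symmetric])

text \<open>By Baire's theorem the remainder \<open>D\<close> is dense in \<open>C\<close>, so it
  inherits from \<open>C\<close> that no point is isolated. It is also a G-delta set in
  \<open>C\<close>, hence completely metrizable, and a nonempty perfect set in such a space has at
  least continuum many points.\<close>

lemma lepoll_perfect_minus_meagre:
  fixes C :: "'a::complete_space set"
  assumes C: "closed C" "C \<noteq> {}" and "countable \<G>" and closed: "\<And>G. G \<in> \<G> \<Longrightarrow> closed G"
    and nowhere_dense: "\<And>s e G. s \<in> C \<Longrightarrow> e > 0 \<Longrightarrow> G \<in> \<G> \<Longrightarrow> \<exists>q\<in>C. dist s q < e \<and> q \<notin> G"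
    and perfect: "\<And>s e. s \<in> C \<Longrightarrow> e > 0 \<Longrightarrow> \<exists>q\<in>C. dist s q < e \<and> q \<noteq> s"
  shows "(UNIV :: real set) \<lesssim> C - \<Union>\<G>"
proof -
  define D where "D = C - \<Union>\<G>"
  have "top_of_set C interior_of \<Union>((\<inter>) C ` \<G>) = {}"
  proof (rule Baire_category_alt)
    show "completely_metrizable_space (top_of_set C) \<or> locally_compact_space (top_of_set C) \<and> regular_space (top_of_set C)"
      using C(1) completely_metrizable_space_closedin completely_metrizable_space_euclidean by force
    show "countable ((\<inter>) C ` \<G>)"
      using \<open>countable \<G>\<close> by simp
    fix T assume "T \<in> (\<inter>) C ` \<G>"
    then obtain G where G: "G \<in> \<G>" "T = C \<inter> G"
      by blast
    have "top_of_set C interior_of T = {}"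
    proof (rule ccontr)
      assume "top_of_set C interior_of T \<noteq> {}"
      then obtain s U where "s \<in> U" "openin (top_of_set C) U" "U \<subseteq> T"
        by (auto simp: interior_of_def)
      then obtain V where V: "open V" "s \<in> V" "s \<in> C" "C \<inter> V \<subseteq> G"
        using G by (auto simp: openin_open)
      then obtain e where "e > 0" "ball s e \<subseteq> V"
        using open_contains_ball by blast
      then show False
        using nowhere_dense[OF V(3) \<open>e > 0\<close> G(1)] V(4) by auto
    qed
    with G closed show "closedin (top_of_set C) T \<and> top_of_set C interior_of T = {}"
      by (simp add: closedin_closed_Int)
  qed
  have dense: "\<exists>q\<in>D. dist s q < e" if "s \<in> C" "e > 0" for s e
  proof (rule ccontr)
    assume "\<not> ?thesis"
    then have "C \<inter> ball s e \<subseteq> \<Union>((\<inter>) C ` \<G>)"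
      by (auto simp: D_def)
    moreover have "openin (top_of_set C) (C \<inter> ball s e)"
      by (simp add: openin_open_Int)
    ultimately have "C \<inter> ball s e \<subseteq> top_of_set C interior_of \<Union>((\<inter>) C ` \<G>)"
      by (rule interior_of_maximal)
    with \<open>top_of_set C interior_of _ = {}\<close> that show False
      by auto
  qed
  have limpt: "s islimpt D" if "s \<in> D" for s
    unfolding islimpt_approachable
  proof (intro allI impI)
    fix e :: real assume "e > 0"
    have "s \<in> C"
      using that by (simp add: D_def)
    then obtain q where q: "q \<in> C" "dist s q < e" "q \<noteq> s"
      using perfect \<open>e > 0\<close> by blast
    \<comment> \<open>The first bound keeps \<open>p\<close> within \<open>e\<close> of
      \<open>s\<close>; the second keeps it different from \<open>s\<close>.\<close>
    then obtain p where "p \<in> D" "dist q p < min (e - dist s q) (dist s q)"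
      using dense[of q "min (e - dist s q) (dist s q)"] by auto
    then show "\<exists>x'\<in>D. x' \<noteq> s \<and> dist x' s < e"
      using dist_triangle[of s p q] by (intro bexI[of _ p]) (auto simp: dist_commute)
  qed
  have gdelta: "gdelta_in (top_of_set C) D"
  \<comment> \<open>The empty family is separate because its intersection would be
    \<open>UNIV\<close> instead of \<open>C\<close>.\<close>
  proof (cases "\<G> = {}")
    case True
    then show ?thesis
      by (simp add: D_def open_imp_gdelta_in)
  next
    case False
    have "D = \<Inter>((\<lambda>G. C - G) ` \<G>)"
      using False by (auto simp: D_def)
    moreover have "gdelta_in (top_of_set C) (C - G)" if "G \<in> \<G>" for G
    proof (rule open_imp_gdelta_in)
      have "C - G = C \<inter> (- G)"
        by blast
      then show "openin (top_of_set C) (C - G)"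
        using closed[OF that] by (simp add: openin_open_Int open_Compl)
    qed
    ultimately show ?thesis
      using False \<open>countable \<G>\<close> gdelta_in_Inter[of "(\<lambda>G. C - G) ` \<G>" "top_of_set C"] by auto
  qed
  have "completely_metrizable_space (top_of_set C)"
    using C(1) completely_metrizable_space_closedin completely_metrizable_space_euclidean by force
  then have "completely_metrizable_space (subtopology (top_of_set C) D)"
    using gdelta by (rule completely_metrizable_space_gdelta_in)
  moreover have "subtopology (top_of_set C) D = top_of_set D"
    by (simp add: subtopology_subtopology D_def Int_absorb1)
  moreover have "top_of_set D derived_set_of D = D"
    using limpt by (fastforce simp: in_derived_set_of islimpt_def openin_open)
  moreover have "D \<noteq> {}"
    using dense[of _ 1] C(2) by auto
  ultimately show ?thesis
    using lepoll_perfect_set[of "top_of_set D" D] by (simp add: D_def)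
qed


section \<open>The norm of \<open>\<ell>\<^sub>1\<close> and its unit vectors\<close>

lift_definition unit_ell1 :: "'i \<Rightarrow> 'i ell1" is "\<lambda>j i. if i = j then 1 else 0"
  subgoal for j
    by (rule summable_on_cong_neutral[where S = "{j}", THEN iffD1]) auto
  done

lemma ell1_nth_arith [simp]:
  "ell1_nth 0 i = 0" "ell1_nth (x + y) i = ell1_nth x i + ell1_nth y i"
  "ell1_nth (x - y) i = ell1_nth x i - ell1_nth y i" "ell1_nth (t *\<^sub>R x) i = t * ell1_nth x i"
  "ell1_nth (unit_ell1 j) i = (if i = j then 1 else 0)"
  by (simp_all add: zero_ell1.rep_eq plus_ell1.rep_eq minus_ell1.rep_eq scaleR_ell1.rep_eq unit_ell1.rep_eq)

lemma ell1_nth_sum: "ell1_nth (sum f A) i = (\<Sum>a\<in>A. ell1_nth (f a) i)"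
  by (induction A rule: infinite_finite_induct) auto

lemma abs_summable_ell1_nth_on: "(\<lambda>i. \<bar>ell1_nth x i\<bar>) summable_on A"
  using summable_on_subset_banach[OF abs_summable_ell1_nth[of x], of A] by simp

lemma norm_ell1_split:
  "norm x = (\<Sum>\<^sub>\<infinity>i\<in>A. \<bar>ell1_nth x i\<bar>) + (\<Sum>\<^sub>\<infinity>i\<in>-A. \<bar>ell1_nth x i\<bar>)"
  using infsum_Un_disjoint[of "\<lambda>i. \<bar>ell1_nth x i\<bar>" A "- A"]
  by (simp add: norm_ell1.rep_eq abs_summable_ell1_nth_on)

text \<open>Only one summand of the norm changes. This exact formula makes distances along a ray in
  a coordinate direction computable.\<close>

lemma norm_add_unit_ell1:
  "norm (x + t *\<^sub>R unit_ell1 j) = norm x - \<bar>ell1_nth x j\<bar> + \<bar>ell1_nth x j + t\<bar>"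
proof -
  have "(\<Sum>\<^sub>\<infinity>i\<in>-{j}. \<bar>ell1_nth (x + t *\<^sub>R unit_ell1 j) i\<bar>) = (\<Sum>\<^sub>\<infinity>i\<in>-{j}. \<bar>ell1_nth x i\<bar>)"
    by (rule infsum_cong) auto
  then show ?thesis
    using norm_ell1_split[of x "{j}"] norm_ell1_split[of "x + t *\<^sub>R unit_ell1 j" "{j}"] by simp
qed

lemma norm_unit_ell1 [simp]: "norm (unit_ell1 j) = 1"
  using norm_add_unit_ell1[of 0 1 j] by simp

text \<open>Pushing any one coordinate of \<open>x - c\<close> away from 0 increases the norm. This
  serves to step off a sphere to its outside.\<close>

lemma ex_norm_gt_near:
  fixes x c :: "'i ell1"
  assumes "e > 0"
  obtains y where "dist x y = e" "norm (x - c) < norm (y - c)"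
proof -
  fix j :: 'i
  obtain t :: real where t: "\<bar>t\<bar> = e" "\<bar>ell1_nth (x - c) j\<bar> < \<bar>ell1_nth (x - c) j + t\<bar>"
    using assms that[of e] that[of "- e"] by (cases "ell1_nth (x - c) j \<ge> 0") auto
  show ?thesis
  proof (rule that)
    show "dist x (x + t *\<^sub>R unit_ell1 j) = e"
      by (simp add: dist_norm t(1))
    show "norm (x - c) < norm (x + t *\<^sub>R unit_ell1 j - c)"
      using t(2) norm_add_unit_ell1[of "x - c" t j] by (simp add: algebra_simps)
  qed
qed

lemma ell1_nth_tendsto_0: "(\<lambda>j. ell1_nth x j) \<longlonglongrightarrow> 0" for x :: "nat ell1"
proof -
  have "summable (\<lambda>j. \<bar>ell1_nth x j\<bar>)"
    using abs_summable_ell1_nth[of x] summable_on_UNIV_nonneg_real_iff[of "\<lambda>j. \<bar>ell1_nth x j\<bar>"] by simp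
  then show ?thesis
    using summable_LIMSEQ_zero tendsto_rabs_zero_iff by blast
qed

text \<open>Finitely supported rational vectors are dense, and an infinite index set has only as
  many finite sets of (index, rational) pairs as it has elements.\<close>

lemma dense_ell1:
  assumes "infinite (UNIV :: 'i set)"
  obtains D :: "'i ell1 set" where "D \<lesssim> (UNIV :: 'i set)" "\<And>x e. e > 0 \<Longrightarrow> \<exists>d\<in>D. dist x d < e"
proof
  define g :: "('i \<times> rat) set \<Rightarrow> 'i ell1"
    where "g S = (\<Sum>p\<in>S. real_of_rat (snd p) *\<^sub>R unit_ell1 (fst p))" for S
  have "(UNIV :: rat set) \<lesssim> (UNIV :: nat set)"
    by (simp add: lepoll_def) (meson inj_to_nat)
  also have "(UNIV :: nat set) \<lesssim> (UNIV :: 'i set)"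
    using assms infinite_le_lepoll by blast
  finally have rat: "(UNIV :: rat set) \<lesssim> (UNIV :: 'i set)" .
  have inf: "infinite (UNIV :: ('i \<times> rat) set)"
    using assms by (simp add: finite_prod)
  have "g ` Fpow UNIV \<lesssim> Fpow (UNIV :: ('i \<times> rat) set)"
    by (rule image_lepoll)
  also have "\<dots> \<approx> (UNIV :: ('i \<times> rat) set)"
    by (rule eqpoll_Fpow[OF inf])
  also have "(UNIV :: ('i \<times> rat) set) \<lesssim> (UNIV :: 'i set) \<times> (UNIV :: 'i set)"
    using times_lepoll_mono[OF lepoll_refl[of "UNIV :: 'i set"] rat] by simp
  also have "\<dots> \<approx> (UNIV :: 'i set)"
    using card_of_Times_same_infinite[OF assms] by (simp add: eqpoll_iff_card_of_ordIso)
  finally show "g ` Fpow UNIV \<lesssim> (UNIV :: 'i set)" .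
  fix x :: "'i ell1" and e :: real assume "e > 0"
  have "((\<lambda>i. \<bar>ell1_nth x i\<bar>) has_sum norm x) UNIV"
    using abs_summable_ell1_nth[of x] by (simp add: norm_ell1.rep_eq)
  then obtain F where F: "finite F" "dist (\<Sum>i\<in>F. \<bar>ell1_nth x i\<bar>) (norm x) \<le> e / 3"
    using has_sum_finite_approximation[of "\<lambda>i. \<bar>ell1_nth x i\<bar>" UNIV "norm x" "e / 3"] \<open>e > 0\<close> by auto
  \<comment> \<open>The \<open>+ 1\<close> keeps the denominator positive for empty
    \<open>F\<close>; the errors on \<open>F\<close> still sum to at most
    \<open>e / 3\<close>.\<close>
  have "\<exists>q. \<bar>ell1_nth x i - real_of_rat q\<bar> \<le> e / 3 / (card F + 1)" for i
  proof -
    have "0 < e / 3 / (card F + 1)"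
      using \<open>e > 0\<close> by simp
    then obtain q where "ell1_nth x i < real_of_rat q" "real_of_rat q < ell1_nth x i + e / 3 / (card F + 1)"
      using of_rat_dense[of "ell1_nth x i" "ell1_nth x i + e / 3 / (card F + 1)"] by auto
    then show ?thesis
      by (intro exI[of _ q]) linarith
  qed
  then obtain q where q: "\<And>i. \<bar>ell1_nth x i - real_of_rat (q i)\<bar> \<le> e / 3 / (card F + 1)"
    by metis
  define S where "S = (\<lambda>i. (i, q i)) ` F"
  have "g S = (\<Sum>i\<in>F. real_of_rat (q i) *\<^sub>R unit_ell1 i)"
    unfolding g_def S_def by (subst sum.reindex) (auto simp: inj_on_def)
  then have nth: "ell1_nth (g S) i = (if i \<in> F then real_of_rat (q i) else 0)" for i
    using F(1) by (simp add: ell1_nth_sum if_distrib cong: if_cong)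
  have "(\<Sum>\<^sub>\<infinity>i\<in>F. \<bar>ell1_nth (x - g S) i\<bar>) \<le> (\<Sum>i\<in>F. e / 3 / (card F + 1))"
    using F(1) sum_mono[of F, OF q] by (simp add: nth)
  also have "\<dots> \<le> e / 3"
    using \<open>e > 0\<close> by (simp add: field_simps)
  finally have 1: "(\<Sum>\<^sub>\<infinity>i\<in>F. \<bar>ell1_nth (x - g S) i\<bar>) \<le> e / 3" .
  have "(\<Sum>\<^sub>\<infinity>i\<in>-F. \<bar>ell1_nth (x - g S) i\<bar>) = (\<Sum>\<^sub>\<infinity>i\<in>-F. \<bar>ell1_nth x i\<bar>)"
    by (rule infsum_cong) (simp add: nth)
  also have "\<dots> \<le> e / 3"
    using norm_ell1_split[of x F] F by (simp add: dist_real_def)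
  finally have "dist x (g S) < e"
    using norm_ell1_split[of "x - g S" F] 1 \<open>e > 0\<close> by (simp add: dist_norm)
  moreover have "S \<in> Fpow UNIV"
    using F(1) by (simp add: Fpow_def S_def)
  ultimately show "\<exists>d\<in>g ` Fpow UNIV. dist x d < e"
    by blast
qed

text \<open>Every ball contains a point of a dense set of size at most that of \<open>'i\<close>,
  and each such point accounts for finitely many balls only.\<close>

lemma point_finite_balls_lepoll:
  fixes c :: "'k \<Rightarrow> 'i ell1"
  assumes inf: "infinite (UNIV :: 'i set)" and r: "\<And>k. k \<in> I \<Longrightarrow> r k > 0"
    and fin: "\<And>y. finite {k \<in> I. y \<in> ball (c k) (r k)}"
  shows "I \<lesssim> (UNIV :: 'i set)"
proof -
  obtain D :: "'i ell1 set" where D: "D \<lesssim> (UNIV :: 'i set)" "\<And>x e. e > 0 \<Longrightarrow> \<exists>d\<in>D. dist x d < e"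
    using dense_ell1[OF inf] by blast
  have "I \<subseteq> (\<Union>d\<in>D. {k \<in> I. d \<in> ball (c k) (r k)})"
    using D(2) r by auto
  then have "I \<lesssim> (\<Union>d\<in>D. {k \<in> I. d \<in> ball (c k) (r k)})"
    by (rule subset_imp_lepoll)
  also have "\<dots> \<lesssim> (UNIV :: 'i set)"
    by (rule UN_lepoll_infinite) (use inf D(1) fin finite_lepoll_infinite in auto)
  finally show ?thesis .
qed


section \<open>Coverings of the separable space by balls and degenerate balls\<close>

text \<open>
  The balls are indexed, and radii \<open>\<le> 0\<close> are allowed, because this system arises as the trace
  of a family of balls on a coordinate subspace: there a ball leaves a ball, a point or nothing.
\<close>

locale ball_covering =
  fixes I :: "'k set" and c :: "'k \<Rightarrow> nat ell1" and r :: "'k \<Rightarrow> real"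
  assumes small: "I \<prec> (UNIV :: real set)"
    and covers: "\<And>y. \<exists>k\<in>I. y \<in> cball (c k) (r k)"
    and star_finite: "\<And>k. k \<in> I \<Longrightarrow> r k > 0 \<Longrightarrow> finite {l\<in>I. cball (c k) (r k) \<inter> ball (c l) (r l) \<noteq> {}}"
begin

text \<open>Only open balls are removed: each remaining point lies on the sphere of a proper ball or
  is itself a degenerate ball.\<close>

definition uncovered :: "nat ell1 set"
  where "uncovered = - (\<Union>k\<in>I. ball (c k) (r k))"

lemma closed_uncovered: "closed uncovered"
  unfolding uncovered_def by (intro closed_Compl open_UN) auto

text \<open>All open balls through \<open>y\<close> meet any one of them, which has finitely many
  neighbours.\<close>

lemma point_finite: "finite {k\<in>I. y \<in> ball (c k) (r k)}"
proof (cases "\<exists>k\<in>I. y \<in> ball (c k) (r k)")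
  case True
  then obtain k where k: "k \<in> I" "y \<in> ball (c k) (r k)"
    by blast
  then have "r k > 0"
    by (metis mem_ball zero_le_dist le_less_trans)
  have "{l\<in>I. y \<in> ball (c l) (r l)} \<subseteq> {l\<in>I. cball (c k) (r k) \<inter> ball (c l) (r l) \<noteq> {}}"
    using k ball_subset_cball by blast
  then show ?thesis
    using star_finite[OF k(1) \<open>r k > 0\<close>] finite_subset by blast
next
  case False
  then have "{k\<in>I. y \<in> ball (c k) (r k)} = {}"
    by blast
  then show ?thesis
    by (metis finite.emptyI)
qed

lemma countable_balls: "countable {k\<in>I. r k > 0}"
proof -
  have "finite {k \<in> {k\<in>I. r k > 0}. y \<in> ball (c k) (r k)}" for y
    by (rule finite_subset[OF _ point_finite[of y]]) auto
  then have "{k\<in>I. r k > 0} \<lesssim> (UNIV :: nat set)"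
    by (intro point_finite_balls_lepoll[where c = c and r = r]) auto
  then show ?thesis
    using countable_lepoll[OF countableI_type] by blast
qed

lemma centers_small: "\<not> (UNIV :: real set) \<lesssim> c ` I"
proof
  assume "(UNIV :: real set) \<lesssim> c ` I"
  also have "c ` I \<lesssim> I"
    by (rule image_lepoll)
  finally show False
    using small lepoll_antisym unfolding lesspoll_def by blast
qed

text \<open>An open set missing all open balls also misses the proper closed balls, so it consists
  of degenerate balls. It contains a segment, however, which has continuum many points.\<close>

lemma open_meets_ball:
  assumes "open U" "U \<noteq> {}"
  obtains k m where "k \<in> I" "m \<in> U" "m \<in> ball (c k) (r k)"
proof (rule ccontr)
  assume "\<not> thesis"
  with that have disj: "\<forall>k\<in>I. U \<inter> ball (c k) (r k) = {}"
    by blast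
  have "U \<subseteq> c ` I"
  proof
    fix y assume "y \<in> U"
    obtain k where k: "k \<in> I" "y \<in> cball (c k) (r k)"
      using covers by blast
    have "\<not> r k > 0"
    proof
      assume "r k > 0"
      then have "U \<inter> cball (c k) (r k) = {}"
        using bspec[OF disj k(1)] open_Int_closure_eq_empty[OF \<open>open U\<close>, of "ball (c k) (r k)"] by simp
      with k \<open>y \<in> U\<close> show False
        by blast
    qed
    with k have "y = c k"
      by (metis dist_le_zero_iff mem_cball not_less order_trans)
    with k show "y \<in> c ` I"
      by blast
  qed
  obtain m e where m: "e > 0" "ball m e \<subseteq> U"
    using assms open_contains_ball by blast
  have "(UNIV :: real set) \<lesssim> {0<..<e}"
    using open_interval_eqpoll_reals[of 0 e] m(1) eqpoll_imp_lepoll eqpoll_sym by blast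
  also have "{0<..<e} \<lesssim> c ` I"
    unfolding lepoll_def
  proof (intro exI conjI)
    let ?f = "\<lambda>t. m + t *\<^sub>R unit_ell1 (0::nat)"
    show "inj_on ?f {0<..<e}"
    proof (rule inj_onI)
      fix s t assume "?f s = ?f t"
      then have "s = t \<or> unit_ell1 (0::nat) = 0"
        by simp
      then show "s = t"
        by (metis norm_unit_ell1 norm_zero zero_neq_one)
    qed
    have "?f t \<in> ball m e" if "t \<in> {0<..<e}" for t
      using that by (simp add: dist_norm)
    then show "?f ` {0<..<e} \<subseteq> c ` I"
      using m(2) \<open>U \<subseteq> c ` I\<close> by blast
  qed
  finally show False
    using centers_small by blast
qed

text \<open>
  Among the balls containing \<open>m\<close>, take those of maximal depth \<open>\<rho>\<close> at \<open>m\<close>. The ray from \<open>m\<close> in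
  direction \<open>e\<^sub>j\<close> leaves each of them at a time tending to \<open>\<rho>\<close>; the point where it leaves the
  last of them is on the boundary of one of them. A ball containing this point in its interior
  would be one of finitely many neighbours: those of maximal depth have been left already, and
  the others are too shallow once \<open>j\<close> is large.
\<close>

lemma exit_points:
  assumes "k0 \<in> I" and m: "m \<in> ball (c k0) (r k0)"
  obtains \<rho> \<tau> where "\<rho> > 0" "\<tau> \<longlonglongrightarrow> \<rho>" "\<And>s. s \<in> uncovered \<Longrightarrow> \<rho> \<le> dist m s"
    "\<forall>\<^sub>F j in sequentially. m + \<tau> j *\<^sub>R unit_ell1 j \<in> uncovered"
proof -
  define N where "N = {l\<in>I. m \<in> ball (c l) (r l)}"
  define depth where "depth l = r l - norm (m - c l)" for l
  define \<rho> where "\<rho> = Max (depth ` N)"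
  define M where "M = {l\<in>N. depth l = \<rho>}"
  define a where "a l j = ell1_nth (m - c l) j" for l j
  \<comment> \<open>For \<open>l\<close> in \<open>M\<close> this is the positive solution
    \<open>t\<close> of \<open>norm (m + t *\<^sub>R unit_ell1 j - c l) = r l\<close>, that is, of
    \<open>\<bar>a l j + t\<bar> = \<rho> + \<bar>a l j\<bar>\<close>.\<close>
  define exit where "exit l j = \<rho> + (\<bar>a l j\<bar> - a l j)" for l j
  define \<tau> where "\<tau> j = Max ((\<lambda>l. exit l j) ` M)" for j
  have N: "finite N" "k0 \<in> N"
    using point_finite assms by (auto simp: N_def)
  have depth_pos: "depth l > 0 \<longleftrightarrow> l \<in> N" if "l \<in> I" for l
    using that by (auto simp: N_def depth_def dist_norm norm_minus_commute)
  have depth_le: "depth l \<le> \<rho>" if "l \<in> N" for l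
    using N that by (simp add: \<rho>_def)
  have "\<rho> \<in> depth ` N"
    using N unfolding \<rho>_def by (intro Max_in) auto
  then obtain k where k: "k \<in> M"
    by (auto simp: M_def)
  have M: "finite M" "M \<subseteq> N" "N \<subseteq> I"
    using N(1) by (simp_all add: M_def) (auto simp: N_def)
  have "\<rho> > 0"
    using k M depth_pos by (auto simp: M_def)
  have norm_ray: "norm (m + t *\<^sub>R unit_ell1 j - c l) = norm (m - c l) - \<bar>a l j\<bar> + \<bar>a l j + t\<bar>" for t j l
    using norm_add_unit_ell1[of "m - c l" t j] by (simp add: a_def algebra_simps)
  have a_lim: "(\<lambda>j. a l j) \<longlonglongrightarrow> 0" for l
    unfolding a_def by (rule ell1_nth_tendsto_0)
  have exit_le: "exit l j \<le> \<tau> j" if "l \<in> M" for l j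
    using M that by (simp add: \<tau>_def)
  have exit_ex: "\<exists>l\<in>M. \<tau> j = exit l j" for j
  proof -
    have "\<tau> j \<in> (\<lambda>l. exit l j) ` M"
      using M k unfolding \<tau>_def by (intro Max_in) auto
    then show ?thesis
      by auto
  qed
  have \<tau>_lower: "\<rho> \<le> \<tau> j" for j
    using exit_le[OF k, of j] by (simp add: exit_def)
  have \<tau>: "\<tau> \<longlonglongrightarrow> \<rho>"
  proof (rule real_tendsto_sandwich[where f = "\<lambda>_. \<rho>"])
    \<comment> \<open>The maximum of finitely many nonnegative delays is bounded by their sum, whose
      limit is immediate.\<close>
    have "\<tau> j \<le> \<rho> + (\<Sum>l\<in>M. \<bar>a l j\<bar> - a l j)" for j
    proof -
      obtain l where l: "l \<in> M" "\<tau> j = exit l j"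
        using exit_ex by blast
      have "\<bar>a l j\<bar> - a l j \<le> (\<Sum>l\<in>M. \<bar>a l j\<bar> - a l j)"
        using M l by (intro member_le_sum) auto
      with l show ?thesis
        by (simp add: exit_def)
    qed
    then show "\<forall>\<^sub>F j in sequentially. \<tau> j \<le> \<rho> + (\<Sum>l\<in>M. \<bar>a l j\<bar> - a l j)"
      by simp
    show "(\<lambda>j. \<rho> + (\<Sum>l\<in>M. \<bar>a l j\<bar> - a l j)) \<longlonglongrightarrow> \<rho>"
      by (rule tendsto_eq_intros a_lim refl | simp)+
  qed (use \<tau>_lower in auto)
  \<comment> \<open>Each exit point lies in a closed ball from \<open>M\<close>, so only these
    finitely many open balls can contain it; finiteness gives one threshold for \<open>j\<close>
    that serves them all.\<close>
  define nbrs where "nbrs = (\<Union>l\<in>M. {h\<in>I. cball (c l) (r l) \<inter> ball (c h) (r h) \<noteq> {}})"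
  have "finite nbrs"
    unfolding nbrs_def
  proof (intro finite_UN_I star_finite)
    fix l assume "l \<in> M"
    then show "l \<in> I"
      using M by blast
    show "r l > 0"
      using \<open>l \<in> M\<close> \<open>\<rho> > 0\<close> norm_ge_zero[of "m - c l"] unfolding M_def depth_def mem_Collect_eq by linarith
  qed (rule M)
  have "\<forall>\<^sub>F j in sequentially. m + \<tau> j *\<^sub>R unit_ell1 j \<notin> ball (c h) (r h)" if "h \<in> nbrs - M" for h
  proof -
    have "h \<in> I"
      using that by (auto simp: nbrs_def)
    have "depth h < \<rho>"
    proof (cases "h \<in> N")
      case True
      then show ?thesis
        using depth_le[of h] that by (auto simp: M_def)
    next
      case False
      then show ?thesis
        using depth_pos[OF \<open>h \<in> I\<close>] \<open>\<rho> > 0\<close> by linarith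
    qed
    \<comment> \<open>In the limit the ray moves straight away from \<open>c h\<close>, since the
      coordinates of \<open>m - c h\<close> vanish; a ball of depth below \<open>\<rho>\<close> is
      thus left behind.\<close>
    have "(\<lambda>j. norm (m + \<tau> j *\<^sub>R unit_ell1 j - c h)) \<longlonglongrightarrow> norm (m - c h) - \<bar>0\<bar> + \<bar>0 + \<rho>\<bar>"
      unfolding norm_ray by (intro tendsto_intros a_lim \<tau>)
    moreover have "r h < norm (m - c h) - \<bar>0\<bar> + \<bar>0 + \<rho>\<bar>"
      using \<open>depth h < \<rho>\<close> \<open>\<rho> > 0\<close> by (simp add: depth_def)
    ultimately have "\<forall>\<^sub>F j in sequentially. r h < norm (m + \<tau> j *\<^sub>R unit_ell1 j - c h)"
      by (rule order_tendstoD)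
    then show ?thesis
      by eventually_elim (simp add: dist_norm norm_minus_commute)
  qed
  then have "\<forall>\<^sub>F j in sequentially. \<forall>h\<in>nbrs - M. m + \<tau> j *\<^sub>R unit_ell1 j \<notin> ball (c h) (r h)"
    using \<open>finite nbrs\<close> by (simp add: eventually_ball_finite)
  then have "\<forall>\<^sub>F j in sequentially. m + \<tau> j *\<^sub>R unit_ell1 j \<in> uncovered"
  proof eventually_elim
    case (elim j)
    define q where "q = m + \<tau> j *\<^sub>R unit_ell1 j"
    have "q \<notin> ball (c h) (r h)" if "h \<in> I" for h
    proof
      assume q: "q \<in> ball (c h) (r h)"
      obtain l where l: "l \<in> M" "\<tau> j = exit l j"
        using exit_ex by blast
      have "norm (q - c l) = norm (m - c l) + \<rho>"
        using norm_ray[of "\<tau> j" j l] \<open>\<rho> > 0\<close> by (simp add: q_def l(2) exit_def)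
      also have "\<dots> = r l"
        using l(1) by (auto simp: M_def depth_def)
      finally have "q \<in> cball (c l) (r l)"
        by (simp add: dist_norm norm_minus_commute)
      with q \<open>h \<in> I\<close> l(1) have "h \<in> nbrs"
        unfolding nbrs_def by blast
      with elim q have "h \<in> M"
        unfolding q_def by blast
      then have "\<bar>a h j + \<tau> j\<bar> < \<rho> + \<bar>a h j\<bar>"
        using q norm_ray[of "\<tau> j" j h] by (simp add: q_def dist_norm norm_minus_commute M_def depth_def)
      then have "\<tau> j < exit h j"
        unfolding exit_def by linarith
      with exit_le[OF \<open>h \<in> M\<close>, of j] show False
        by linarith
    qed
    then show ?case
      by (simp add: q_def uncovered_def)
  qed
  moreover have "\<rho> \<le> dist m s" if "s \<in> uncovered" for s
  proof -
    \<comment> \<open>By the triangle inequality the open ball of radius \<open>\<rho>\<close> about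
      \<open>m\<close> lies inside ball \<open>k\<close>, which \<open>s\<close> avoids.\<close>
    have "r k \<le> norm (s - c k)"
      using that k M by (force simp: uncovered_def dist_norm norm_minus_commute)
    moreover have "norm (s - c k) \<le> norm (m - c k) + dist m s"
      using norm_triangle_ineq[of "m - c k" "s - m"] by (simp add: dist_norm norm_minus_commute)
    moreover have "\<rho> = r k - norm (m - c k)"
      using k by (simp add: M_def depth_def)
    ultimately show ?thesis
      by linarith
  qed
  ultimately show ?thesis
    using that \<open>\<rho> > 0\<close> \<tau> by blast
qed

text \<open>Exit points of rays from a point \<open>m\<close> near \<open>s\<close> stay near
  \<open>s\<close>, because \<open>\<rho> \<le> dist m s\<close>. If \<open>m\<close> is outside the
  given ball, their distance to \<open>c0\<close> tends to the even larger
  \<open>norm (m - c0) + \<rho>\<close>.\<close>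

lemma uncovered_escapes_ball:
  assumes s: "s \<in> uncovered" "s \<notin> ball c0 r0" and "e > 0"
  shows "\<exists>q\<in>uncovered. dist s q < e \<and> q \<notin> cball c0 r0"
proof -
  \<comment> \<open>As \<open>s\<close> may lie on the sphere, \<open>y\<close> is what shows that
    points near \<open>s\<close> exist outside the closed ball.\<close>
  obtain y where y: "dist s y = e / 8" "norm (s - c0) < norm (y - c0)"
    using ex_norm_gt_near[of "e / 8" s c0] \<open>e > 0\<close> by auto
  have "y \<in> ball s (e / 4) - cball c0 r0"
    using y s(2) \<open>e > 0\<close> by (auto simp: dist_norm norm_minus_commute)
  then have "open (ball s (e / 4) - cball c0 r0)" "ball s (e / 4) - cball c0 r0 \<noteq> {}"
    by (auto simp: open_Diff)
  then obtain k m where k: "k \<in> I" "m \<in> ball (c k) (r k)" and m: "m \<in> ball s (e / 4) - cball c0 r0"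
    by (rule open_meets_ball)
  obtain \<rho> \<tau> where "\<rho> > 0" and \<tau>: "\<tau> \<longlonglongrightarrow> \<rho>" and "\<rho> \<le> dist m s"
    and q: "\<forall>\<^sub>F j in sequentially. m + \<tau> j *\<^sub>R unit_ell1 j \<in> uncovered"
    using exit_points[OF k] s(1) by metis
  have "(\<lambda>j. norm (m + \<tau> j *\<^sub>R unit_ell1 j - c0)) \<longlonglongrightarrow> norm (m - c0) - \<bar>0\<bar> + \<bar>0 + \<rho>\<bar>"
  proof -
    have "norm (m + \<tau> j *\<^sub>R unit_ell1 j - c0)
        = norm (m - c0) - \<bar>ell1_nth (m - c0) j\<bar> + \<bar>ell1_nth (m - c0) j + \<tau> j\<bar>" for j
      using norm_add_unit_ell1[of "m - c0" "\<tau> j" j] by (simp add: algebra_simps)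
    then show ?thesis
      by (simp only:) (intro tendsto_intros ell1_nth_tendsto_0 \<tau>)
  qed
  moreover have "r0 < norm (m - c0) - \<bar>0\<bar> + \<bar>0 + \<rho>\<bar>"
    using m \<open>\<rho> > 0\<close> by (simp add: dist_norm norm_minus_commute)
  ultimately have "\<forall>\<^sub>F j in sequentially. r0 < norm (m + \<tau> j *\<^sub>R unit_ell1 j - c0)"
    by (rule order_tendstoD)
  moreover have "\<forall>\<^sub>F j in sequentially. \<tau> j < e / 2"
    using m \<open>\<rho> \<le> dist m s\<close> \<open>e > 0\<close> by (intro order_tendstoD[OF \<tau>]) (auto simp: dist_commute)
  moreover have "\<forall>\<^sub>F j in sequentially. 0 < \<tau> j"
    using \<open>\<rho> > 0\<close> by (intro order_tendstoD[OF \<tau>])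
  ultimately have "\<forall>\<^sub>F j in sequentially. \<exists>q\<in>uncovered. dist s q < e \<and> q \<notin> cball c0 r0"
    using q
  proof eventually_elim
    case (elim j)
    have "dist s (m + \<tau> j *\<^sub>R unit_ell1 j) \<le> dist s m + \<tau> j"
      using dist_triangle[of s "m + \<tau> j *\<^sub>R unit_ell1 j" m] elim(3) by (simp add: dist_norm)
    then show ?case
      using elim m \<open>e > 0\<close>
      by (intro bexI[of _ "m + \<tau> j *\<^sub>R unit_ell1 j"]) (auto simp: dist_norm norm_minus_commute)
  qed
  then show ?thesis
    by simp
qed

lemma uncovered_nonempty: "uncovered \<noteq> {}"
proof -
  obtain k m where "k \<in> I" "m \<in> ball (c k) (r k)"
    using open_meets_ball[of UNIV] by auto
  then obtain \<tau> where "\<forall>\<^sub>F j in sequentially. m + \<tau> j *\<^sub>R unit_ell1 j \<in> uncovered"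
    using exit_points by metis
  then show ?thesis
    using eventually_happens' sequentially_bot by blast
qed

theorem contradiction: False
proof -
  define \<G> where "\<G> = (\<lambda>k. cball (c k) (r k)) ` {k\<in>I. r k > 0}"
  have "(UNIV :: real set) \<lesssim> uncovered - \<Union>\<G>"
  proof (rule lepoll_perfect_minus_meagre)
    show "countable \<G>"
      using countable_balls by (simp add: \<G>_def)
  next
    fix s e G assume "s \<in> uncovered" "(e::real) > 0" "G \<in> \<G>"
    \<comment> \<open>A point of \<open>uncovered\<close> is outside the open ball whose closed ball
      is \<open>G\<close>, as the escape lemma requires.\<close>
    then show "\<exists>q\<in>uncovered. dist s q < e \<and> q \<notin> G"
      using uncovered_escapes_ball by (fastforce simp: \<G>_def uncovered_def)
  next
    fix s e assume "s \<in> uncovered" "(e::real) > 0"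
    then show "\<exists>q\<in>uncovered. dist s q < e \<and> q \<noteq> s"
      \<comment> \<open>With radius 0 the ball to escape is the point \<open>s\<close> itself, and
        \<open>ball s 0\<close> is empty.\<close>
      using uncovered_escapes_ball[of s s 0 e] by auto
  qed (auto simp: \<G>_def closed_uncovered uncovered_nonempty)
  also have "uncovered - \<Union>\<G> \<subseteq> c ` I"
  proof
    fix y assume y: "y \<in> uncovered - \<Union>\<G>"
    obtain k where k: "k \<in> I" "y \<in> cball (c k) (r k)"
      using covers by blast
    with y have "\<not> r k > 0"
      by (auto simp: \<G>_def)
    with k have "y = c k"
      by (metis dist_le_zero_iff mem_cball not_less order_trans)
    with k show "y \<in> c ` I"
      by blast
  qed
  then have "uncovered - \<Union>\<G> \<lesssim> c ` I"
    by (rule subset_imp_lepoll)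
  finally show False
    using centers_small by blast
qed

end


section \<open>Reduction to the separable space\<close>

text \<open>The distance from \<open>emb y\<close> to a centre splits into the distance to its
  projection plus a constant \<open>tail\<close>. Hence each ball has as trace a ball of radius
  \<open>r k - tail (c k)\<close>, possibly nonpositive, and both covering and finiteness of
  neighbours pass to the traces.\<close>

lemma ball_covering_false:
  fixes c :: "'k \<Rightarrow> 'i ell1"
  assumes inf: "infinite (UNIV :: 'i set)" and small: "(UNIV :: 'i set) \<prec> (UNIV :: nat set set)"
    and pos: "\<And>k. k \<in> I \<Longrightarrow> r k > 0" and covers: "\<And>y. \<exists>k\<in>I. y \<in> cball (c k) (r k)"
    and star_finite: "\<And>k. k \<in> I \<Longrightarrow> finite {l\<in>I. cball (c k) (r k) \<inter> ball (c l) (r l) \<noteq> {}}"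
  shows False
proof -
  obtain f :: "nat \<Rightarrow> 'i" where "inj f"
    using inf infinite_countable_subset by blast
  define proj :: "'i ell1 \<Rightarrow> nat ell1" where "proj x = Abs_ell1 (\<lambda>n. ell1_nth x (f n))" for x
  define emb :: "nat ell1 \<Rightarrow> 'i ell1"
    where "emb y = Abs_ell1 (\<lambda>i. if i \<in> range f then ell1_nth y (inv_into UNIV f i) else 0)" for y
  define tail :: "'i ell1 \<Rightarrow> real" where "tail x = (\<Sum>\<^sub>\<infinity>i\<in>-range f. \<bar>ell1_nth x i\<bar>)" for x
  have proj: "ell1_nth (proj x) n = ell1_nth x (f n)" for x n
  proof -
    have "(\<lambda>n. \<bar>ell1_nth x (f n)\<bar>) summable_on UNIV"
      using summable_on_reindex[OF \<open>inj f\<close>, of "\<lambda>i. \<bar>ell1_nth x i\<bar>"] abs_summable_ell1_nth_on[of x "range f"]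
      by (simp add: o_def)
    then show ?thesis
      by (simp add: proj_def Abs_ell1_inverse)
  qed
  have emb: "ell1_nth (emb y) i = (if i \<in> range f then ell1_nth y (inv_into UNIV f i) else 0)" for y i
  proof -
    let ?g = "\<lambda>i. if i \<in> range f then ell1_nth y (inv_into UNIV f i) else 0"
    have "(\<lambda>i. \<bar>?g i\<bar>) summable_on range f"
      using summable_on_reindex[OF \<open>inj f\<close>, of "\<lambda>i. \<bar>?g i\<bar>"] abs_summable_ell1_nth[of y] \<open>inj f\<close>
      by (simp add: o_def)
    then have "(\<lambda>i. \<bar>?g i\<bar>) summable_on UNIV"
      by (rule summable_on_cong_neutral[THEN iffD1, rotated -1]) auto
    then show ?thesis
      by (simp add: emb_def Abs_ell1_inverse)
  qed
  have norm: "norm (emb y - x) = norm (y - proj x) + tail x" for x y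
  proof -
    have "(\<Sum>\<^sub>\<infinity>i\<in>range f. \<bar>ell1_nth (emb y - x) i\<bar>) = (\<Sum>\<^sub>\<infinity>n. \<bar>ell1_nth (emb y - x) (f n)\<bar>)"
      using infsum_reindex[OF \<open>inj f\<close>, of "\<lambda>i. \<bar>ell1_nth (emb y - x) i\<bar>"] by (simp add: o_def)
    also have "\<dots> = norm (y - proj x)"
      using \<open>inj f\<close> by (simp add: norm_ell1.rep_eq emb proj)
    moreover have "(\<Sum>\<^sub>\<infinity>i\<in>-range f. \<bar>ell1_nth (emb y - x) i\<bar>) = tail x"
      unfolding tail_def by (rule infsum_cong) (simp add: emb)
    ultimately show ?thesis
      using norm_ell1_split[of "emb y - x" "range f"] by simp
  qed
  have cball_iff: "y \<in> cball (proj (c k)) (r k - tail (c k)) \<longleftrightarrow> emb y \<in> cball (c k) (r k)"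
    and ball_iff: "y \<in> ball (proj (c k)) (r k - tail (c k)) \<longleftrightarrow> emb y \<in> ball (c k) (r k)" for y k
    using norm[of y "c k"] by (auto simp: dist_norm norm_minus_commute)
  \<comment> \<open>Point-finiteness in the full space bounds the number of balls by the size of
    \<open>'i\<close>, hence below the continuum.\<close>
  have "finite {k \<in> I. y \<in> ball (c k) (r k)}" for y
  proof -
    obtain k where "k \<in> I" "y \<in> cball (c k) (r k)"
      using covers by blast
    then have "{k \<in> I. y \<in> ball (c k) (r k)} \<subseteq> {l\<in>I. cball (c k) (r k) \<inter> ball (c l) (r l) \<noteq> {}}"
      by blast
    then show ?thesis
      using star_finite[OF \<open>k \<in> I\<close>] finite_subset by blast
  qed
  with inf pos have "I \<lesssim> (UNIV :: 'i set)"
    by (rule point_finite_balls_lepoll)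
  also have "(UNIV :: 'i set) \<prec> (UNIV :: real set)"
    using small nat_sets_eqpoll_reals by (rule lesspoll_eq_trans)
  finally have I: "I \<prec> (UNIV :: real set)" .
  interpret ball_covering I "\<lambda>k. proj (c k)" "\<lambda>k. r k - tail (c k)"
  proof
    show "I \<prec> (UNIV :: real set)"
      by (rule I)
    show "\<exists>k\<in>I. y \<in> cball (proj (c k)) (r k - tail (c k))" for y
      unfolding cball_iff by (rule covers)
    fix k assume "k \<in> I"
    have "{l\<in>I. cball (proj (c k)) (r k - tail (c k)) \<inter> ball (proj (c l)) (r l - tail (c l)) \<noteq> {}}
        \<subseteq> {l\<in>I. cball (c k) (r k) \<inter> ball (c l) (r l) \<noteq> {}}"
      using cball_iff ball_iff by blast
    then show "finite {l\<in>I. cball (proj (c k)) (r k - tail (c k)) \<inter> ball (proj (c l)) (r l - tail (c l)) \<noteq> {}}"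
      using star_finite[OF \<open>k \<in> I\<close>] finite_subset by blast
  qed
  show False
    by (rule contradiction)
qed

text \<open>Tiles have nonempty interior, so this yields the positive radii that the definition of a
  tiling by balls leaves implicit.\<close>

lemma interior_cball_nonpos:
  fixes x :: "'i ell1"
  assumes "r \<le> 0"
  shows "interior (cball x r) = {}"
proof (rule ccontr)
  assume "interior (cball x r) \<noteq> {}"
  then obtain y e where "e > 0" "cball y e \<subseteq> cball x r"
    by (meson ex_in_conv mem_interior_cball)
  moreover obtain z where "dist y z = e" "norm (y - x) < norm (z - x)"
    using ex_norm_gt_near \<open>e > 0\<close> by blast
  ultimately have "norm (z - x) \<le> r" "norm (z - x) > 0"
    using norm_ge_zero[of "y - x"] by (force simp: dist_norm norm_minus_commute, linarith)
  then show False
    using assms by linarith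
qed

theorem theoremA:
  fixes n :: nat
  assumes "infinite (UNIV :: 'i set)"
    and "(UNIV :: 'i set) \<prec> (UNIV :: nat set set)"
    and "n \<ge> 1"
  shows "\<not> (\<exists>\<F> :: 'i ell1 set set. tiling \<F> \<and> (\<forall>B\<in>\<F>. \<exists>x r. B = cball x r)) \<and>
    \<not> (\<exists>\<F> :: 'i ell1 set set. covering \<F> \<and> star_n_finite n \<F> \<and>
        (\<forall>B\<in>\<F>. \<exists>x r. r > 0 \<and> B = cball x r))"
proof -
  \<comment> \<open>Meeting interiors of only finitely many members is the property shared by both
    kinds of family.\<close>
  have no_covering: False
    if "\<Union>\<F> = UNIV" and balls: "\<And>B. B \<in> \<F> \<Longrightarrow> \<exists>x r. r > 0 \<and> B = cball x r"
      and fin: "\<And>F. F \<in> \<F> \<Longrightarrow> finite {G\<in>\<F>. F \<inter> interior G \<noteq> {}}"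
    for \<F> :: "'i ell1 set set"
  proof -
    obtain c r where cr: "\<And>B. B \<in> \<F> \<Longrightarrow> r B > 0 \<and> B = cball (c B) (r B)"
      using balls by metis
    show False
    proof (rule ball_covering_false[OF assms(1,2), of \<F> r c])
      show "r B > 0" if "B \<in> \<F>" for B
        using cr that by blast
      show "\<exists>B\<in>\<F>. y \<in> cball (c B) (r B)" for y
        using \<open>\<Union>\<F> = UNIV\<close> cr by blast
      fix B assume "B \<in> \<F>"
      have "ball (c G) (r G) \<subseteq> interior G" if "G \<in> \<F>" for G
        using cr[OF that] ball_subset_cball by (metis interior_maximal open_ball)
      then have "{G\<in>\<F>. cball (c B) (r B) \<inter> ball (c G) (r G) \<noteq> {}} \<subseteq> {G\<in>\<F>. B \<inter> interior G \<noteq> {}}"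
        using cr[OF \<open>B \<in> \<F>\<close>] by blast
      then show "finite {G\<in>\<F>. cball (c B) (r B) \<inter> ball (c G) (r G) \<noteq> {}}"
        using fin[OF \<open>B \<in> \<F>\<close>] finite_subset by blast
    qed
  qed
  have False if \<F>: "tiling \<F>" "\<forall>B\<in>\<F>. \<exists>x r. B = cball x r" for \<F> :: "'i ell1 set set"
  proof (rule no_covering)
    show "\<Union>\<F> = UNIV"
      using \<F>(1) by (simp add: tiling_def covering_def)
    show balls: "\<exists>x r. r > 0 \<and> B = cball x r" if "B \<in> \<F>" for B
      using \<F> that interior_cball_nonpos by (metis tiling_def linorder_not_less)
    fix F assume "F \<in> \<F>"
    then obtain x r where F: "r > 0" "F = cball x r"
      using balls by blast
    \<comment> \<open>An open set disjoint from the open ball misses its closure \<open>F\<close>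
      too, so a tile meets no interior but its own.\<close>
    have "F = G" if "G \<in> \<F>" "F \<inter> interior G \<noteq> {}" for G
    proof (rule ccontr)
      assume "F \<noteq> G"
      then have "interior G \<inter> interior F = {}"
        using \<F>(1) \<open>F \<in> \<F>\<close> \<open>G \<in> \<F>\<close> unfolding tiling_def non_overlapping_def by blast
      then have "interior G \<inter> ball x r = {}"
        using F ball_subset_cball interior_maximal[of "ball x r" F] by blast
      then have "interior G \<inter> closure (ball x r) = {}"
        by (simp add: open_Int_closure_eq_empty)
      with F that(2) show False
        by auto
    qed
    then have "{G\<in>\<F>. F \<inter> interior G \<noteq> {}} \<subseteq> {F}"
      by blast
    then show "finite {G\<in>\<F>. F \<inter> interior G \<noteq> {}}"
      using finite_subset by blast
  qed
  moreover have False
    if \<F>: "covering \<F>" "star_n_finite n \<F>" "\<forall>B\<in>\<F>. \<exists>x r. r > 0 \<and> B = cball x r" for \<F> :: "'i ell1 set set"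
  proof (rule no_covering)
    show "\<Union>\<F> = UNIV"
      using \<F>(1) by (simp add: covering_def)
    show "\<exists>x r. r > 0 \<and> B = cball x r" if "B \<in> \<F>" for B
      using \<F>(3) that by blast
    fix F assume "F \<in> \<F>"
    \<comment> \<open>Star-finiteness counts the other members only, while \<open>F\<close> also
      meets its own interior.\<close>
    then have "finite (insert F {G \<in> \<F> - {F}. F \<inter> G \<noteq> {}})"
      using \<F>(2) by (simp add: star_n_finite_def)
    moreover have "{G\<in>\<F>. F \<inter> interior G \<noteq> {}} \<subseteq> insert F {G \<in> \<F> - {F}. F \<inter> G \<noteq> {}}"
      using interior_subset by blast
    ultimately show "finite {G\<in>\<F>. F \<inter> interior G \<noteq> {}}"
      using finite_subset by blast
  qed
  ultimately show ?thesis
    by blast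
qed

end
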